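(* Let $g(z)$ be a power series with real coefficients and $g(0)\ne0$, let $a\neq0$ be real, and let $\{G_n(s)\}_{n\ge0}$ be the Appell sequence for the pair $(g,az)$, i.e. $\sum_{n\ge0}G_n(s)\frac{z^n}{n!}=g(z)e^{asz}$. Then the following are equivalent: (i) for every $n\ge1$, the zeros of $G_n(s)$ are symmetric with respect to the line $\operatorname{Re}s=-\frac{g'(0)}{2a}$; (ii) for every $n\ge1$, $G_n(-s)=(-1)^nG_n\!\left(s-\frac{g'(0)}{a}\right)$; (iii) $g(z)=g(-z)e^{g'(0)z}$.
   Context: The zeros of a polynomial are symmetric with respect to the line $\operatorname{Re}s=\kappa$ ($\kappa\in\mathbb{R}$) if the multiset of its complex zeros (counted with multiplicity) is invariant under the reflection $s\mapsto 2\kappa-\overline{s}$. Power series are formal. *)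

theory Defs
  imports Complex_Main "HOL-Computational_Algebra.Computational_Algebra"
begin

definition complex_fps :: "real fps \<Rightarrow> complex fps" where
  "complex_fps g = Abs_fps (\<lambda>n. complex_of_real (fps_nth g n))"

(* \<open>\<Sum>n. G\<^sub>n(s) z\<^sup>n / n! = g(z) exp(a s z)\<close>, an identity of formal power series in \<open>z\<close> for each
   complex number \<open>s\<close>; this determines the polynomials \<open>G\<^sub>n\<close>. *)
definition appell_sequence :: "real fps \<Rightarrow> real \<Rightarrow> (nat \<Rightarrow> complex poly) \<Rightarrow> bool" where
  "appell_sequence g a G \<longleftrightarrow>
     (\<forall>s. Abs_fps (\<lambda>n. poly (G n) s / fact n) =
          complex_fps g * fps_exp (complex_of_real a * s))"

(* \<open>proots p\<close> is the multiset of the zeros of \<open>p\<close>, counted with multiplicity. *)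
definition zeros_symmetric :: "real \<Rightarrow> complex poly \<Rightarrow> bool" where
  "zeros_symmetric \<kappa> p \<longleftrightarrow>
     image_mset (\<lambda>s. 2 * complex_of_real \<kappa> - cnj s) (proots p) = proots p"

lemma appell_sequence_exists: "\<exists>G. appell_sequence g a G"
proof
  let ?G = "\<lambda>n. \<Sum>k\<le>n. monom (fact n * complex_of_real (fps_nth g k * a ^ (n - k)) / fact (n - k)) (n - k)"
  show "appell_sequence g a ?G"
    unfolding appell_sequence_def complex_fps_def
    by (auto simp: fps_eq_iff fps_mult_nth poly_sum poly_monom power_mult_distrib
        sum_divide_distrib atLeast0AtMost intro!: sum.cong)
qed

lemma appell_sequence_unique:
  assumes "appell_sequence g a G" "appell_sequence g a H"
  shows "G = H"
proof
  fix n
  have "poly (G n) s = poly (H n) s" for s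
  proof -
    have "Abs_fps (\<lambda>n. poly (G n) s / fact n) = Abs_fps (\<lambda>n. poly (H n) s / fact n)"
      using assms by (simp add: appell_sequence_def)
    then have "poly (G n) s / fact n = poly (H n) s / fact n"
      by (simp only: fps_eq_iff fps_nth_Abs_fps)
    then show ?thesis by simp
  qed
  then have "poly (G n) = poly (H n)" by (rule ext)
  then show "G n = H n" by (rule poly_eq_poly_eq_iff[THEN iffD1])
qed

end

theory Submission
  imports Defs
begin

text \<open>
  The polynomial \<open>G\<^sub>n\<close> has real coefficients and degree \<open>n\<close>, and a polynomial over \<open>\<complex>\<close> is determined by
  its leading coefficient and its multiset of zeros. Since the zeros are closed under conjugation,
  their symmetry about \<open>Re s = \<kappa>\<close> amounts to \<open>G\<^sub>n(2\<kappa> - s) = (-1)\<^sup>n G\<^sub>n(s)\<close>, which is (ii) after a shift.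
  Multiplying (ii) by \<open>z\<^sup>n / n!\<close> and summing gives \<open>g(z) exp(-a s z) = g(-z) exp(-a s z) exp(g'(0) z)\<close>,
  which is (iii) because the exponential is a unit.
\<close>

lemma all_uminus: "(\<forall>x. P (- x)) \<longleftrightarrow> (\<forall>x :: 'a :: group_add. P x)"
  by (metis minus_minus)

lemma proots_prod_linear:
  fixes A :: "'a :: idom multiset"
  shows "proots (\<Prod>x\<in>#A. [:-x, 1:]) = A"
proof (induction A)
  case (add x A)
  have "(\<Prod>x\<in>#A. [:-x, 1:]) \<noteq> 0"
    by (simp add: prod_mset_zero_iff image_iff)
  with add show ?case
    by (simp add: proots_mult del: mult_pCons_left)
qed auto

text \<open>Factor by factor: as \<open>c\<close> is real, \<open>s - (c - cnj x)\<close> is minus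
  the conjugate of \<open>(c - cnj s) - x\<close>, so each of the \<open>size A\<close> factors
  contributes one sign.\<close>

lemma poly_prod_linear_reflect:
  assumes "cnj c = c"
  shows "poly (\<Prod>x\<in>#A. [:-(c - cnj x), 1:]) s =
         (-1) ^ size A * cnj (poly (\<Prod>x\<in>#A. [:-x, 1:]) (c - cnj s))"
  by (induction A) (auto simp: assms algebra_simps)

lemma zeros_symmetric_iff:
  assumes "\<And>k. coeff p k \<in> \<real>" and "p \<noteq> 0"
  shows "zeros_symmetric \<kappa> p \<longleftrightarrow>
         (\<forall>s. poly p s = (-1) ^ degree p * poly p (2 * complex_of_real \<kappa> - s))"
proof -
  define A where "A = proots p"
  define c where "c = 2 * complex_of_real \<kappa>"
  define P where "P = (\<Prod>x\<in>#A. [:-x, 1:])"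
  define Q where "Q = (\<Prod>x\<in>#A. [:-(c - cnj x), 1:])"
  have Q_eq: "Q = (\<Prod>x\<in>#image_mset (\<lambda>s. c - cnj s) A. [:-x, 1:])"
    by (simp add: Q_def image_mset.compositionality o_def)
  have cnj_c: "cnj c = c" by (simp add: c_def)
  have p: "p = smult (lead_coeff p) P"
    using complex_poly_decompose_multiset[of p] by (simp add: P_def A_def)
  have size_A: "size A = degree p" by (simp add: A_def size_proots_complex)
  have lc: "lead_coeff p \<noteq> 0" "cnj (lead_coeff p) = lead_coeff p"
    using assms by (auto simp: Reals_cnj_iff)
  \<comment> \<open>Conjugation enters through the reflection \<open>s \<mapsto> c - cnj s\<close>
    and leaves again because \<open>p\<close> has real coefficients.\<close>
  have Q: "lead_coeff p * poly Q s = (-1) ^ degree p * poly p (c - s)" for s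
  proof -
    have "lead_coeff p * poly Q s = (-1) ^ degree p * cnj (lead_coeff p * poly P (c - cnj s))"
      using poly_prod_linear_reflect[OF cnj_c, of A s] by (simp add: Q_def P_def size_A lc(2))
    also have "lead_coeff p * poly P (c - cnj s) = poly p (c - cnj s)"
      by (metis p poly_smult)
    also have "cnj (poly p (c - cnj s)) = poly p (c - s)"
      using poly_cnj_real[OF assms(1), of "c - cnj s"] by (simp add: cnj_c)
    finally show ?thesis .
  qed
  have "proots P = A" "proots Q = image_mset (\<lambda>s. c - cnj s) A"
    unfolding P_def Q_eq by (rule proots_prod_linear)+
  moreover have "image_mset (\<lambda>s. c - cnj s) A = A \<Longrightarrow> Q = P"
    by (simp only: Q_eq P_def)
  \<comment> \<open>\<open>P\<close> and \<open>Q\<close> are both monic, so they are equal exactly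
    when their multisets of zeros are.\<close>
  ultimately have "image_mset (\<lambda>s. c - cnj s) A = A \<longleftrightarrow> P = Q"
    by metis
  also have "\<dots> \<longleftrightarrow> (\<forall>s. lead_coeff p * poly P s = lead_coeff p * poly Q s)"
    using lc(1)
    by (simp only: poly_eq_poly_eq_iff[symmetric] fun_eq_iff mult_cancel_left simp_thms)
  also have "\<dots> \<longleftrightarrow> (\<forall>s. poly p s = (-1) ^ degree p * poly p (c - s))"
    unfolding Q using arg_cong[OF p, of poly] by (simp add: fun_eq_iff)
  finally show ?thesis
    by (simp add: zeros_symmetric_def A_def c_def)
qed

lemma coeff_appell_sequence:
  assumes "appell_sequence g a G"
  shows "coeff (G n) k =
         (if k \<le> n then complex_of_real (fact n * fps_nth g (n - k) * a ^ k / fact k) else 0)"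
proof -
  define H where
    "H = (\<Sum>k\<le>n. monom (complex_of_real (fact n * fps_nth g (n - k) * a ^ k / fact k)) k)"
  have "poly (G n) s = poly H s" for s
  proof -
    have "poly (G n) s / fact n =
          fps_nth (complex_fps g * fps_exp (complex_of_real a * s)) n"
      using assms unfolding appell_sequence_def by (metis fps_nth_Abs_fps)
    \<comment> \<open>With the exponential first, the summation index of the convolution is the
      power of \<open>s\<close>, as in \<open>H\<close>.\<close>
    also have "\<dots> = fps_nth (fps_exp (complex_of_real a * s) * complex_fps g) n"
      by (simp only: mult.commute)
    also have "\<dots> = poly H s / fact n"
      by (auto simp: H_def complex_fps_def fps_mult_nth poly_sum poly_monom power_mult_distrib
          sum_divide_distrib atLeast0AtMost intro!: sum.cong)
    finally show ?thesis by simp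
  qed
  then have "G n = H"
    by (simp add: poly_eq_poly_eq_iff[symmetric] fun_eq_iff)
  then show ?thesis
    by (auto simp: H_def coeff_sum)
qed

text \<open>The coefficient of \<open>s ^ n\<close> is \<open>g(0) * a ^ n\<close>, which is
  nonzero.\<close>

lemma degree_appell_sequence:
  assumes "appell_sequence g a G" "fps_nth g 0 \<noteq> 0" "a \<noteq> 0"
  shows "degree (G n) = n"
proof (rule antisym)
  show "degree (G n) \<le> n"
    by (rule degree_le) (simp add: coeff_appell_sequence[OF assms(1)])
  show "n \<le> degree (G n)"
    by (rule le_degree) (simp add: coeff_appell_sequence[OF assms(1)] assms(2,3))
qed

text \<open>The generating functions are complex series, while (iii) is about real ones. This lemma
  and the next three transfer the identity between the two.\<close>

lemma complex_fps_inject: "complex_fps f = complex_fps g \<longleftrightarrow> f = g"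
  by (simp add: complex_fps_def fps_eq_iff)

lemma complex_fps_mult: "complex_fps (f * g) = complex_fps f * complex_fps g"
  by (simp add: complex_fps_def fps_eq_iff fps_mult_nth)

lemma complex_fps_exp: "complex_fps (fps_exp c) = fps_exp (complex_of_real c)"
  by (simp add: complex_fps_def fps_eq_iff)

lemma complex_fps_compose_uminus_X:
  "complex_fps (fps_compose g (- fps_X)) = fps_compose (complex_fps g) (- fps_X)"
  by (simp add: complex_fps_def fps_eq_iff fps_compose_uminus')

text \<open>The sign \<open>(-1) ^ n\<close> is the substitution of \<open>-z\<close> for
  \<open>z\<close> in the generating function. Including \<open>n = 0\<close> makes the family of
  identities one equation of power series for each \<open>s\<close>.\<close>

lemma appell_sequence_reflection_iff:
  assumes "appell_sequence g a G" "a \<noteq> 0"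
  shows "(\<forall>n. \<forall>s. poly (G n) (- s) = (-1) ^ n * poly (G n) (s - complex_of_real (c / a))) \<longleftrightarrow>
         g = fps_compose g (- fps_X) * fps_exp c"
proof -
  define F where "F s = Abs_fps (\<lambda>n. poly (G n) s / fact n)" for s
  define h where "h = complex_fps g"
  have F: "F s = h * fps_exp (complex_of_real a * s)" for s
    using assms(1) by (simp add: appell_sequence_def F_def h_def)
  have unit: "f * fps_exp x = f' * fps_exp x \<longleftrightarrow> f = f'" for f f' :: "complex fps" and x
    by (metis fps_exp_neq_0 mult_right_cancel)
  have shift: "fps_compose (F (s - complex_of_real (c / a))) (- fps_X) =
               fps_compose h (- fps_X) * fps_exp (complex_of_real c)
                 * fps_exp (complex_of_real a * (- s))" for s
  proof -
    have "- (complex_of_real a * (s - complex_of_real (c / a))) =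
          complex_of_real c + complex_of_real a * (- s)"
      using assms(2) by (simp add: field_simps)
    moreover have "fps_compose (F (s - complex_of_real (c / a))) (- fps_X) =
        fps_compose h (- fps_X) * fps_exp (- (complex_of_real a * (s - complex_of_real (c / a))))"
      by (simp add: F fps_compose_mult_distrib)
    ultimately show ?thesis
      by (simp only: fps_exp_add_mult mult.assoc)
  qed
  have "(\<forall>n. \<forall>s. poly (G n) (- s) = (-1) ^ n * poly (G n) (s - complex_of_real (c / a))) \<longleftrightarrow>
        (\<forall>s. F (- s) = fps_compose (F (s - complex_of_real (c / a))) (- fps_X))"
    by (auto simp: F_def fps_eq_iff fps_compose_uminus')
  \<comment> \<open>Both sides carry the factor \<open>exp(-a s z)\<close>; cancelling it leaves an
    equation free of \<open>s\<close>.\<close>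
  also have "\<dots> \<longleftrightarrow> h = fps_compose h (- fps_X) * fps_exp (complex_of_real c)"
    unfolding shift unfolding F unit by simp
  also have "\<dots> \<longleftrightarrow> g = fps_compose g (- fps_X) * fps_exp c"
    by (simp add: h_def flip: complex_fps_inject complex_fps_mult complex_fps_exp
        complex_fps_compose_uminus_X)
  finally show ?thesis .
qed

theorem theorem4:
  fixes g :: "real fps" and a :: real and G :: "nat \<Rightarrow> complex poly"
  assumes "fps_nth g 0 \<noteq> 0"
    and "a \<noteq> 0"
    and "appell_sequence g a G"
  shows "((\<forall>n\<ge>1. zeros_symmetric (- fps_nth (fps_deriv g) 0 / (2 * a)) (G n)) \<longleftrightarrow>
          (\<forall>n\<ge>1. \<forall>s. poly (G n) (- s) =
             (-1) ^ n * poly (G n) (s - complex_of_real (fps_nth (fps_deriv g) 0 / a)))) \<and>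
         ((\<forall>n\<ge>1. \<forall>s. poly (G n) (- s) =
             (-1) ^ n * poly (G n) (s - complex_of_real (fps_nth (fps_deriv g) 0 / a))) \<longleftrightarrow>
          g = fps_compose g (- fps_X) * fps_exp (fps_nth (fps_deriv g) 0))"
proof
  define c where "c = fps_nth (fps_deriv g) 0"
  have deg: "degree (G n) = n" for n
    by (rule degree_appell_sequence[OF assms(3,1,2)])
  have "zeros_symmetric (- c / (2 * a)) (G n) \<longleftrightarrow>
        (\<forall>s. poly (G n) (- s) = (-1) ^ n * poly (G n) (s - complex_of_real (c / a)))" for n
  proof -
    have "coeff (G n) k \<in> \<real>" for k
      unfolding coeff_appell_sequence[OF assms(3)]
      by (cases "k \<le> n") (simp_all only: if_True if_False Reals_of_real Reals_0)
    moreover have "G n \<noteq> 0"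
      using coeff_appell_sequence[OF assms(3), of n n] assms(1,2) by auto
    \<comment> \<open>For \<open>\<kappa> = -c / (2 * a)\<close> the reflected point
      \<open>2 * \<kappa> - s\<close> is \<open>-s - c / a\<close>; replacing \<open>s\<close> by
      \<open>-s\<close> then gives the form in (ii).\<close>
    ultimately have "zeros_symmetric (- c / (2 * a)) (G n) \<longleftrightarrow>
        (\<forall>s. poly (G n) s = (-1) ^ n * poly (G n) (- s - complex_of_real (c / a)))"
      using zeros_symmetric_iff[of "G n" "- c / (2 * a)"] by (simp add: deg minus_diff_commute)
    then show ?thesis
      using all_uminus[of "\<lambda>s. poly (G n) s = (-1) ^ n * poly (G n) (- s - complex_of_real (c / a))"]
      by (simp only: minus_minus)
  qed
  then show "(\<forall>n\<ge>1. zeros_symmetric (- fps_nth (fps_deriv g) 0 / (2 * a)) (G n)) \<longleftrightarrow>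
          (\<forall>n\<ge>1. \<forall>s. poly (G n) (- s) =
             (-1) ^ n * poly (G n) (s - complex_of_real (fps_nth (fps_deriv g) 0 / a)))"
    by (simp only: c_def)
  have "poly (G 0) s = poly (G 0) t" for s t
    using deg[of 0] by (metis degree_eq_zeroE poly_const_conv)
  then have "(\<forall>n\<ge>1. \<forall>s. poly (G n) (- s) = (-1) ^ n * poly (G n) (s - complex_of_real (c / a))) \<longleftrightarrow>
        (\<forall>n. \<forall>s. poly (G n) (- s) = (-1) ^ n * poly (G n) (s - complex_of_real (c / a)))"
    by (metis less_one mult_1 not_le power_0)
  then show "(\<forall>n\<ge>1. \<forall>s. poly (G n) (- s) =
             (-1) ^ n * poly (G n) (s - complex_of_real (fps_nth (fps_deriv g) 0 / a))) \<longleftrightarrow>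
          g = fps_compose g (- fps_X) * fps_exp (fps_nth (fps_deriv g) 0)"
    using appell_sequence_reflection_iff[OF assms(3,2), of c] by (simp only: c_def)
qed

end
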